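(* Let $T$ be a semi-infinite banded stochastic matrix admitting a positive bidiagonal factorization, let $N\in\mathbb N_0$, and let $\hat T^{[N]}=\frac{1}{\lambda_0^{[N]}}\delta(u_0^{\langle N\rangle})^{-1}T^{[N]}\delta(u_0^{\langle N\rangle})$ be the stochastic matrix obtained by Perron normalization of the truncation $T^{[N]}$. Then the finite Markov chain on $\{0,1,\dots,N\}$ with transition matrix $\hat T^{[N]}$ is aperiodic, i.e. every state has period $1$.
   Context: Semi-infinite matrices are indexed by $\mathbb N_0=\{0,1,2,\dots\}$. Fix integers $p,q\ge1$. $T$ is banded: $T_{n,m}=0$ unless $n-p\le m\le n+q$, with positive entries inside the band. A matrix is stochastic if its entries are nonnegative and every row sums to $1$. A positive bidiagonal factorization of $T$ is a factorization $T=\mathscr L_1\cdots\mathscr L_p\mathscr U_q\cdots\mathscr U_1$ where each $\mathscr L_i$ is lower bidiagonal with positive entries on the main diagonal and first subdiagonal (all other entries zero) and each $\mathscr U_j$ is upper bidiagonal with positive entries on the main diagonal and first superdiagonal (all other entries zero). For a vector $v$, $\delta(v)$ is the diagonal matrix with diagonal entries the entries of $v$. $T^{[N]}=(T_{n,m})_{n,m=0}^N$. Its eigenvalues $\lambda_0^{[N]}>\dots>\lambda_N^{[N]}$ are simple and positive (known), and $u_0^{\langle N\rangle}$ is a right eigenvector of $T^{[N]}$ for $\lambda_0^{[N]}$ with all entries positive (unique up to positive scaling). The period of a state $i$ is the greatest common divisor of all $r\in\mathbb N$ (positive integers) with $((\hat T^{[N]})^r)_{i,i}>0$. *)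

theory Defs
  imports Complex_Main "Jordan_Normal_Form.Spectral_Radius"
    "Jordan_Normal_Form.Gauss_Jordan_Elimination"
begin

text \<open>Semi-infinite real matrices, indexed by pairs of natural numbers starting at 0.\<close>

type_synonym smat = "nat \<Rightarrow> nat \<Rightarrow> real"

text \<open>
  In all uses below the left factor is bidiagonal, so the series has at most two nonzero terms.
\<close>

definition smat_mult :: "smat \<Rightarrow> smat \<Rightarrow> smat" where
  "smat_mult A B = (\<lambda>n m. \<Sum>k. A n k * B k m)"

definition smat_one :: smat where
  "smat_one = (\<lambda>n m. if n = m then 1 else 0)"

definition smat_prod_list :: "smat list \<Rightarrow> smat" where
  "smat_prod_list As = foldr smat_mult As smat_one"

definition positive_banded :: "nat \<Rightarrow> nat \<Rightarrow> smat \<Rightarrow> bool" where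
  "positive_banded p q T \<longleftrightarrow>
     (\<forall>n m. if n \<le> m + p \<and> m \<le> n + q then 0 < T n m else T n m = 0)"

definition stochastic :: "smat \<Rightarrow> bool" where
  "stochastic T \<longleftrightarrow> (\<forall>n. (\<forall>m. 0 \<le> T n m) \<and> T n sums 1)"

definition positive_lower_bidiagonal :: "smat \<Rightarrow> bool" where
  "positive_lower_bidiagonal L \<longleftrightarrow>
     (\<forall>n m. if n = m \<or> n = Suc m then 0 < L n m else L n m = 0)"

definition positive_upper_bidiagonal :: "smat \<Rightarrow> bool" where
  "positive_upper_bidiagonal U \<longleftrightarrow>
     (\<forall>n m. if m = n \<or> m = Suc n then 0 < U n m else U n m = 0)"

text \<open>The factorization is $T = L_1 \cdots L_p\, U_q \cdots U_1$, the upper factors descending.\<close>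

definition positive_bidiagonal_factorization :: "nat \<Rightarrow> nat \<Rightarrow> smat \<Rightarrow> bool" where
  "positive_bidiagonal_factorization p q T \<longleftrightarrow>
     (\<exists>L U. (\<forall>i\<in>{1..p}. positive_lower_bidiagonal (L i)) \<and>
            (\<forall>j\<in>{1..q}. positive_upper_bidiagonal (U j)) \<and>
            T = smat_prod_list (map L [1..<Suc p] @ rev (map U [1..<Suc q])))"

definition truncation :: "smat \<Rightarrow> nat \<Rightarrow> real mat" where
  "truncation T N = mat (Suc N) (Suc N) (\<lambda>(n, m). T n m)"

text \<open>
  The largest real eigenvalue of a real square matrix. The truncations considered here have only
  real eigenvalues $\lambda_0 > \dots > \lambda_N$, and this is $\lambda_0$.
\<close>

definition largest_eigenvalue :: "real mat \<Rightarrow> real" where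
  "largest_eigenvalue A = Max (spectrum A)"

definition delta :: "real vec \<Rightarrow> real mat" where
  "delta v = mat_diag (dim_vec v) (\<lambda>i. v $ i)"

lemma mat_inverse_delta:
  assumes "\<And>i. i < dim_vec v \<Longrightarrow> v $ i \<noteq> 0"
  shows "mat_inverse (delta v) = Some (delta (map_vec inverse v))"
proof -
  define n where "n = dim_vec v"
  let ?D = "delta v" and ?E = "delta (map_vec inverse v)"
  have D: "?D \<in> carrier_mat n n" and E: "?E \<in> carrier_mat n n"
    by (auto simp: delta_def n_def)
  have DE: "?D * ?E = 1\<^sub>m n" and ED: "?E * ?D = 1\<^sub>m n"
    using assms by (auto simp: delta_def n_def mat_diag_def intro!: eq_matI
        simp: scalar_prod_def if_distrib[of "\<lambda>x. x * _"] sum.If_cases)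
  have "?D \<in> Units (ring_mat TYPE(real) n ())"
    using D E DE ED by (auto simp: Units_def ring_mat_def)
  then obtain B where B: "mat_inverse ?D = Some B"
    using mat_inverse(1)[OF D, where b = "()"] by (cases "mat_inverse ?D") auto
  have BD: "B * ?D = 1\<^sub>m n" and Bc: "B \<in> carrier_mat n n"
    using mat_inverse(2)[OF D B] by auto
  have "?E = (B * ?D) * ?E"
    unfolding BD using E by simp
  also have "\<dots> = B * (?D * ?E)"
    by (rule assoc_mult_mat[OF Bc D E])
  also have "\<dots> = B"
    unfolding DE using Bc by simp
  finally show ?thesis using B by simp
qed

definition perron_normalization :: "real mat \<Rightarrow> real vec \<Rightarrow> real mat" where
  "perron_normalization A u =
     (1 / largest_eigenvalue A) \<cdot>\<^sub>m (the (mat_inverse (delta u)) * A * delta u)"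

definition period :: "real mat \<Rightarrow> nat \<Rightarrow> nat" where
  "period P i = Gcd {r. 0 < r \<and> 0 < (P ^\<^sub>m r) $$ (i, i)}"

definition aperiodic :: "real mat \<Rightarrow> bool" where
  "aperiodic P \<longleftrightarrow> (\<forall>i<dim_row P. period P i = 1)"

end

theory Submission
  imports Defs
begin

text \<open>
  The diagonal entries of a truncation lie inside the band, hence are positive, and conjugation by a
  positive diagonal matrix and division by the positive eigenvalue keep them so. Thus 1 is a return
  time of every state. Positivity of the eigenvalue is read off the first coordinate of the
  eigenvalue equation.
\<close>

text \<open>Conjugation by a diagonal matrix acts entrywise. Since \<open>u\<close> has no zero
  entry, \<open>delta u\<close> is invertible with the reciprocals as inverse, so \<open>the\<close>
  returns a genuine inverse.\<close>

lemma perron_normalization_eq: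
  assumes A: "A \<in> carrier_mat n n" and u: "u \<in> carrier_vec n"
    and u0: "\<And>i. i < n \<Longrightarrow> u $ i \<noteq> 0"
  shows "perron_normalization A u =
    mat n n (\<lambda>(i, j). A $$ (i, j) * u $ j / (largest_eigenvalue A * u $ i))"
proof -
  have "the (mat_inverse (delta u)) = delta (map_vec inverse u)"
    using u u0 by (subst mat_inverse_delta) auto
  also have "\<dots> = mat_diag n (\<lambda>i. map_vec inverse u $ i)"
    using u by (simp add: delta_def)
  finally have "the (mat_inverse (delta u)) * A
      = mat n n (\<lambda>(i, j). map_vec inverse u $ i * A $$ (i, j))"
    by (simp only: mat_diag_mult_left[OF A])
  moreover have "delta u = mat_diag n (\<lambda>i. u $ i)"
    using u by (simp add: delta_def)
  ultimately show ?thesis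
    unfolding perron_normalization_def
    \<comment> \<open>A zero \<open>largest_eigenvalue A\<close> is harmless here: division by zero
      gives 0, so both sides vanish.\<close>
    by (intro eq_matI) (use u in \<open>auto simp: mat_diag_mult_right[of _ n n] divide_simps\<close>)
qed

text \<open>In coordinate \<open>i\<close> of the eigenvalue equation, the positive diagonal term
  bounds the sum from below, so a single nonnegative row suffices.\<close>

lemma eigenvalue_pos:
  fixes A :: "real mat"
  assumes A: "A \<in> carrier_mat n n" and eig: "eigenvector A u k" and "i < n"
    and nonneg: "\<And>j. j < n \<Longrightarrow> 0 \<le> A $$ (i, j)" and Aii: "0 < A $$ (i, i)"
    and u: "\<And>j. j < n \<Longrightarrow> 0 < u $ j"
  shows "0 < k"
proof -
  have uc: "u \<in> carrier_vec n" and eq: "A *\<^sub>v u = k \<cdot>\<^sub>v u"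
    using eig A by (auto simp: eigenvector_def)
  have "0 < A $$ (i, i) * u $ i"
    using Aii u[OF \<open>i < n\<close>] by simp
  also have "\<dots> \<le> (\<Sum>j = 0..<n. A $$ (i, j) * u $ j)"
    using \<open>i < n\<close> nonneg u by (intro member_le_sum) (auto simp: less_imp_le)
  also have "\<dots> = (A *\<^sub>v u) $ i"
    using A uc \<open>i < n\<close> by (auto simp: scalar_prod_def)
  also have "\<dots> = k * u $ i"
    using eq uc \<open>i < n\<close> by simp
  finally show ?thesis
    using u[OF \<open>i < n\<close>] by (simp add: zero_less_mult_iff)
qed

lemma aperiodic_if_diagonal_pos:
  assumes P: "P \<in> carrier_mat n n" and pos: "\<And>i. i < n \<Longrightarrow> 0 < P $$ (i, i)"
  shows "aperiodic P"
  unfolding aperiodic_def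
proof (intro allI impI)
  fix i assume i: "i < dim_row P"
  have "P ^\<^sub>m 1 = P"
    using P by simp
  then have "1 \<in> {r. 0 < r \<and> 0 < (P ^\<^sub>m r) $$ (i, i)}"
    using pos i P by simp
  then have "period P i dvd 1"
    unfolding period_def by (rule Gcd_dvd)
  then show "period P i = 1"
    by simp
qed

theorem proposition2p7:
  fixes T :: smat and p q N :: nat and u :: "real vec"
  assumes "1 \<le> p" and "1 \<le> q"
    and "positive_banded p q T"
    and "stochastic T"
    and "positive_bidiagonal_factorization p q T"
    and "eigenvector (truncation T N) u (largest_eigenvalue (truncation T N))"
    and "\<forall>n\<le>N. 0 < u $ n"
  shows "aperiodic (perron_normalization (truncation T N) u)"
proof (rule aperiodic_if_diagonal_pos)
  let ?A = "truncation T N"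
  have A: "?A \<in> carrier_mat (Suc N) (Suc N)"
    by (simp add: truncation_def)
  have u: "u \<in> carrier_vec (Suc N)"
    using assms(6) A by (auto simp: eigenvector_def)
  have upos: "0 < u $ i" if "i < Suc N" for i
    using assms(7) that by simp
  \<comment> \<open>Both band inequalities hold at \<open>n = m = i\<close>, whatever
    \<open>p\<close> and \<open>q\<close> are.\<close>
  have diag: "0 < ?A $$ (i, i)" if "i < Suc N" for i
    using assms(3)[unfolded positive_banded_def, rule_format, of i i] that
    by (simp add: truncation_def)
  have nonneg: "0 \<le> ?A $$ (0, j)" if "j < Suc N" for j
    using assms(4) that by (simp add: truncation_def stochastic_def)
  \<comment> \<open>Row 0 exists for every \<open>N\<close>, as the truncation has size
    \<open>Suc N\<close>.\<close>
  have k: "0 < largest_eigenvalue ?A"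
    by (rule eigenvalue_pos[OF A assms(6) zero_less_Suc nonneg diag[OF zero_less_Suc] upos])
  have u0: "\<And>i. i < Suc N \<Longrightarrow> u $ i \<noteq> 0"
    using upos by (metis less_irrefl)
  note P = perron_normalization_eq[OF A u u0]
  show "perron_normalization ?A u \<in> carrier_mat (Suc N) (Suc N)"
    using P by simp
  \<comment> \<open>On the diagonal the factors \<open>u $ i\<close> cancel, leaving the entry of
    \<open>?A\<close> over the eigenvalue.\<close>
  show "0 < perron_normalization ?A u $$ (i, i)" if i: "i < Suc N" for i
    using P i diag[OF i] k upos[OF i] by simp
qed

end
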